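(* Let $P$ be a ranked, finite, bounded poset of rank $n$, and let $H_P(t)=\sum_{i=0}^{n-1}h_it^i$ be its Chow polynomial. Then the sequence $$\left(h_0,\ h_1-h_0,\ \ldots,\ h_{\lfloor (n-1)/2\rfloor}-h_{\lfloor (n-1)/2\rfloor-1}\right)$$ is a pure $O$-sequence.
   Context: A weak rank function on a poset $P$ is a function $\rho:P\times P\to\mathbb{N}$, $(x,y)\mapsto\rho_{x,y}$, with $\rho_{x,y}>0$ iff $x<y$ and $\rho_{x,y}=\rho_{x,z}+\rho_{z,y}$ for $x\le z\le y$. The poset is ranked if moreover $\rho_{x,y}=1$ whenever $y$ covers $x$. $P$ is bounded with least element $\hat0$ and greatest element $\hat1$; $\rho(x)=\rho_{\hat0,x}$ and the rank of $P$ is $n=\rho(\hat1)$. The Chow polynomial is $$H_P(t)=\sum_{s\ge 0}\ \sum_{\hat0=p_0<p_1<\cdots<p_s\le \hat1}\ \prod_{i=1}^{s}\frac{t\left(t^{\rho(p_i)-\rho(p_{i-1})-1}-1\right)}{t-1}.$$ A monomial order ideal is a finite set of monomials (in finitely many variables) closed under taking divisors; it is pure if all its maximal elements under divisibility have the same degree. Its $h$-vector $(h_0,\ldots,h_e)$ records the number of its monomials of each degree. A pure $O$-sequence is the $h$-vector of a pure monomial order ideal. *)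

theory Defs
  imports "HOL-Computational_Algebra.Polynomial" "HOL-Library.Multiset"
begin

definition covers :: "'a::order \<Rightarrow> 'a \<Rightarrow> bool" where
  "covers y x \<longleftrightarrow> x < y \<and> \<not> (\<exists>z. x < z \<and> z < y)"

(* The poset P is the whole type; the first condition forces the value 0 on all pairs
   with not x < y, incomparable ones included. *)
definition weak_rank_function :: "('a::order \<Rightarrow> 'a \<Rightarrow> nat) \<Rightarrow> bool" where
  "weak_rank_function \<rho> \<longleftrightarrow>
     (\<forall>x y. 0 < \<rho> x y \<longleftrightarrow> x < y) \<and>
     (\<forall>x y z. x \<le> z \<and> z \<le> y \<longrightarrow> \<rho> x y = \<rho> x z + \<rho> z y)"

definition ranked :: "('a::order \<Rightarrow> 'a \<Rightarrow> nat) \<Rightarrow> bool" where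
  "ranked \<rho> \<longleftrightarrow> weak_rank_function \<rho> \<and> (\<forall>x y. covers y x \<longrightarrow> \<rho> x y = 1)"

definition poset_rank :: "('a::{order_bot, order_top} \<Rightarrow> 'a \<Rightarrow> nat) \<Rightarrow> nat" where
  "poset_rank \<rho> = \<rho> bot top"

(* Chains p_0 < p_1 < ... < p_s with p_0 the least element; s is the length minus 1. *)
definition bot_chains :: "'a::order_bot list set" where
  "bot_chains = {ps. ps \<noteq> [] \<and> hd ps = bot \<and> sorted_wrt (<) ps}"

lemma finite_bot_chains: "finite (bot_chains :: 'a::{finite, order_bot} list set)"
proof (rule finite_subset)
  have "distinct ps" if "sorted_wrt (<) ps" for ps :: "'a list"
    using that by (induction ps) auto
  then have "length ps \<le> card (UNIV :: 'a set)" if "sorted_wrt (<) ps" for ps :: "'a list"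
    using that by (metis card_mono distinct_card finite subset_UNIV)
  then show "(bot_chains :: 'a list set) \<subseteq> {ps. set ps \<subseteq> UNIV \<and> length ps \<le> card (UNIV :: 'a set)}"
    by (auto simp: bot_chains_def)
  show "finite {ps :: 'a list. set ps \<subseteq> UNIV \<and> length ps \<le> card (UNIV :: 'a set)}"
    by (rule finite_lists_length_le) simp
qed

(* The factor t (t^(k-1) - 1) / (t - 1); the division is exact, see chow_factor_eq. *)
definition chow_factor :: "nat \<Rightarrow> int poly" where
  "chow_factor k = ([:0, 1:] * ([:0, 1:] ^ (k - 1) - 1)) div ([:0, 1:] - 1)"

lemma chow_factor_eq: "chow_factor k = (\<Sum>j=1..<k. monom 1 j)"
proof -
  let ?t = "[:0, 1:] :: int poly"
  have "?t * (?t ^ (k - 1) - 1) = (?t * (\<Sum>j<k - 1. ?t ^ j)) * (?t - 1)"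
    by (simp only: power_diff_1_eq ac_simps)
  moreover have "?t - 1 \<noteq> 0"
    by (simp add: one_pCons)
  ultimately have "chow_factor k = ?t * (\<Sum>j<k - 1. ?t ^ j)"
    unfolding chow_factor_def by (metis nonzero_mult_div_cancel_right)
  also have "\<dots> = (\<Sum>j<k - 1. ?t ^ Suc j)"
    by (simp only: sum_distrib_left power_Suc)
  also have "\<dots> = (\<Sum>j=1..<k. ?t ^ j)"
    by (rule sum.reindex_bij_witness[of _ "\<lambda>j. j - 1" Suc]) auto
  finally show ?thesis
    by (simp add: monom_altdef)
qed

(* On a chain, weak_rank_function makes all the natural-number subtractions exact. *)
definition chow_poly :: "('a::{finite, order_bot, order_top} \<Rightarrow> 'a \<Rightarrow> nat) \<Rightarrow> int poly" where
  "chow_poly \<rho> =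
     (\<Sum>ps\<in>bot_chains. \<Prod>i=1..<length ps.
        chow_factor (\<rho> bot (ps ! i) - \<rho> bot (ps ! (i - 1))))"

(* A monomial is the multiset of its variables, which are labelled by natural numbers:
   divisibility is the submultiset order and the degree is the size. A finite set of
   monomials involves only finitely many variables. *)
type_synonym monomial = "nat multiset"

definition monomial_order_ideal :: "monomial set \<Rightarrow> bool" where
  "monomial_order_ideal M \<longleftrightarrow> finite M \<and> (\<forall>m\<in>M. \<forall>d. d \<subseteq># m \<longrightarrow> d \<in> M)"

definition maximal_monomials :: "monomial set \<Rightarrow> monomial set" where
  "maximal_monomials M = {m \<in> M. \<not> (\<exists>m'\<in>M. m \<subset># m')}"

definition pure :: "monomial set \<Rightarrow> bool" where
  "pure M \<longleftrightarrow> (\<forall>m\<in>maximal_monomials M. \<forall>m'\<in>maximal_monomials M. size m = size m')"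

(* The vector ends at the largest degree of a monomial in M. *)
definition h_vector :: "monomial set \<Rightarrow> nat list" where
  "h_vector M = map (\<lambda>d. card {m \<in> M. size m = d}) [0..<Suc (Max (size ` M))]"

(* The empty set of monomials is left out because its largest degree is undefined. The
   entries are integers, since differences of coefficients could be negative a priori. *)
definition pure_O_sequence :: "int list \<Rightarrow> bool" where
  "pure_O_sequence hs \<longleftrightarrow>
     (\<exists>M. M \<noteq> {} \<and> monomial_order_ideal M \<and> pure M \<and> hs = map int (h_vector M))"

end

theory Submission
  imports Defs
begin

text \<open>
  Let \<open>c\<^sub>x\<close> be the coefficient function of the Chow polynomial of the interval from \<open>x\<close> to
  the greatest element and let \<open>m\<close> run over the admissible exponents of the first element \<open>y\<close> above
  \<open>x\<close> in a chain. Splitting off \<open>y\<close> shows that \<open>c\<^sub>x\<close> is palindromic and that its difference function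
  is a sum of blocks of the difference functions of the \<open>c\<^sub>y\<close>. The reflection of \<open>c\<^sub>y\<close> cancels part
  of each block; what survives counts the monomials that obey in addition the ballot condition
  that the exponent of \<open>p\<close> plus twice the degree above \<open>p\<close> is at most the corank of \<open>p\<close>
  (in bracket language: the minimal elements of the symmetric chains of monomials).
  The ballot monomials are closed under divisors, and in a ranked poset a ballot monomial
  of less than the largest possible degree can be enlarged: at the lowest place where the chain
  is not saturated, one can raise an exponent or insert an element two ranks higher.
\<close>

section \<open>Reflection cancellation and finite orders\<close>

text \<open>Replacing \<open>m\<close> by \<open>2 * i - N - 1 - m\<close> exchanges
  \<open>i - m\<close> with \<open>N + 1 - (i - m)\<close>, so the two halves of \<open>D\<close>
  cancel over the indices \<open>m < 2 * i - N - 1\<close>. On the other indices the subtracted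
  value of \<open>b\<close> has its argument beyond \<open>N / 2\<close> and vanishes.\<close>

lemma sum_reflection_cancel:
  fixes b D :: "int \<Rightarrow> int" and N i :: int and d :: nat
  assumes D: "\<And>j. D j = b j - b (N + 1 - j)"
    and b0: "\<And>j. 2 * j > N \<Longrightarrow> b j = 0"
    and i: "2 * i \<le> N + int d"
  shows "(\<Sum>m=1..<d. D (i - int m)) =
         (\<Sum>m=1..<d. if 2 * i - int m \<le> N + 1 then b (i - int m) else 0)"
proof -
  define L where "L = {m\<in>{1..<d}. int m < 2 * i - N - 1}"
  define R where "R = {m\<in>{1..<d}. int m \<ge> 2 * i - N - 1}"
  have LR: "{1..<d} = L \<union> R" "L \<inter> R = {}" "finite L" "finite R"
    unfolding L_def R_def by auto
  \<comment> \<open>By \<open>2 * i \<le> N + int d\<close> the reflected index stays below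
    \<open>d\<close>, so the reflection is an involution of \<open>L\<close>.\<close>
  have refl: "(\<Sum>m\<in>L. b (i - int m)) = (\<Sum>m\<in>L. b (N + 1 - (i - int m)))"
    by (rule sum.reindex_bij_witness[of _ "\<lambda>m. nat (2 * i - N - 1 - int m)"
          "\<lambda>m. nat (2 * i - N - 1 - int m)"])
      (use i in \<open>auto simp: L_def algebra_simps nat_less_iff\<close>)
  have "(\<Sum>m\<in>L. D (i - int m)) = 0"
    using refl by (simp add: D sum_subtractf)
  moreover have "(\<Sum>m\<in>L. if 2 * i - int m \<le> N + 1 then b (i - int m) else 0) = 0"
    by (rule sum.neutral) (auto simp: L_def)
  moreover have "(\<Sum>m\<in>R. D (i - int m)) =
      (\<Sum>m\<in>R. if 2 * i - int m \<le> N + 1 then b (i - int m) else 0)"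
    by (rule sum.cong) (auto simp: R_def D b0)
  ultimately show ?thesis
    unfolding LR(1) using LR by (simp add: sum.union_disjoint)
qed

lemma finite_up_induct [case_names less]:
  fixes x :: "'a::{finite, order}"
  assumes "\<And>x. (\<And>y. x < y \<Longrightarrow> P y) \<Longrightarrow> P x"
  shows "P x"
proof (induction "card {x<..}" arbitrary: x rule: less_induct)
  case less
  have "card {y<..} < card {x<..}" if "x < y" for y
    by (rule psubset_card_mono) (use that in auto)
  then show ?case
    using less assms by blast
qed

lemma exists_cover_below:
  fixes x y :: "'a::{finite, order}"
  assumes "x < y"
  obtains z where "covers z x" "z \<le> y"
proof -
  obtain z where "z \<in> {x<..y}" "\<And>w. w \<in> {x<..y} \<Longrightarrow> w \<le> z \<Longrightarrow> z = w"
    using finite_has_minimal[of "{x<..y}"] assms by auto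
  then have z: "x < z" "z \<le> y" "\<And>w. x < w \<Longrightarrow> w < z \<Longrightarrow> z = w"
    by (auto simp: less_imp_le)
  then have "covers z x"
    unfolding covers_def by blast
  with z show thesis using that by blast
qed

section \<open>Chains and the recursion of the Chow polynomial\<close>

definition chains_from :: "'a::order \<Rightarrow> 'a list set" where
  "chains_from x = {ps. ps \<noteq> [] \<and> hd ps = x \<and> sorted_wrt (<) ps}"

lemma chains_from_rec:
  "chains_from x = insert [x] (\<Union>y\<in>{x<..}. (#) x ` chains_from y)" (is "?L = ?R")
proof
  show "?L \<subseteq> ?R"
  proof
    fix ps assume ps: "ps \<in> ?L"
    then obtain qs where qs: "ps = x # qs"
      unfolding chains_from_def by (cases ps) auto
    with ps show "ps \<in> ?R"
      by (cases qs) (auto simp: chains_from_def image_iff intro!: bexI[of _ "hd qs"])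
  qed
next
  have "sorted_wrt (<) (x # qs)" if "x < hd qs" "sorted_wrt (<) qs" "qs \<noteq> []" for qs
    using that by (cases qs) (auto dest: less_trans)
  then show "?R \<subseteq> ?L"
    by (auto simp: chains_from_def)
qed

lemma finite_chains_from: "finite (chains_from (x::'a::{finite, order}))"
  by (induction x rule: finite_up_induct) (subst chains_from_rec, auto)

locale weak_ranked_poset =
  fixes \<rho> :: "'a::{finite, order_bot, order_top} \<Rightarrow> 'a \<Rightarrow> nat"
  assumes weak: "weak_rank_function \<rho>"
begin

lemma rank_pos_iff [simp]: "0 < \<rho> x y \<longleftrightarrow> x < y"
  using weak by (simp add: weak_rank_function_def)

lemma rank_eq_0_iff [simp]: "\<rho> x y = 0 \<longleftrightarrow> \<not> x < y"
  using rank_pos_iff[of x y] by linarith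

lemma rank_add: "x \<le> z \<Longrightarrow> z \<le> y \<Longrightarrow> \<rho> x y = \<rho> x z + \<rho> z y"
  using weak by (simp add: weak_rank_function_def)

lemma rank_top: "x \<le> y \<Longrightarrow> \<rho> x top = \<rho> x y + \<rho> y top"
  by (rule rank_add) simp_all

text \<open>Ranks between consecutive elements replace differences of ranks measured from
  \<open>bot\<close>, so that the weight does not refer to anything below the first element and can
  be computed by splitting that element off.\<close>

definition chain_weight :: "'a list \<Rightarrow> int poly" where
  "chain_weight ps = (\<Prod>i=1..<length ps. chow_factor (\<rho> (ps ! (i - 1)) (ps ! i)))"

lemma chain_weight_singleton [simp]: "chain_weight [x] = 1"
  by (simp add: chain_weight_def)

lemma chain_weight_Cons:
  assumes "qs \<noteq> []"
  shows "chain_weight (x # qs) = chow_factor (\<rho> x (hd qs)) * chain_weight qs"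
proof -
  have "{1..<length (x # qs)} = insert 1 (Suc ` {1..<length qs})"
    using assms by (cases qs) (auto simp: image_Suc_atLeastLessThan)
  then have "chain_weight (x # qs) = chow_factor (\<rho> x (qs ! 0)) *
      (\<Prod>i\<in>Suc ` {1..<length qs}. chow_factor (\<rho> ((x # qs) ! (i - 1)) ((x # qs) ! i)))"
    unfolding chain_weight_def by (simp only:) (subst prod.insert, auto)
  also have "(\<Prod>i\<in>Suc ` {1..<length qs}. chow_factor (\<rho> ((x # qs) ! (i - 1)) ((x # qs) ! i)))
      = chain_weight qs"
    unfolding chain_weight_def
    by (subst prod.reindex) (auto intro!: prod.cong simp: nth_Cons')
  finally show ?thesis
    using assms by (simp add: hd_conv_nth)
qed

definition upper_chow :: "'a \<Rightarrow> int poly" where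
  "upper_chow x = (\<Sum>ps\<in>chains_from x. chain_weight ps)"

lemma chow_poly_eq_upper_chow: "chow_poly \<rho> = upper_chow bot"
  unfolding chow_poly_def upper_chow_def chain_weight_def bot_chains_def chains_from_def
proof (intro sum.cong prod.cong refl)
  fix ps :: "'a list" and i
  assume "ps \<in> {ps. ps \<noteq> [] \<and> hd ps = bot \<and> sorted_wrt (<) ps}" and i: "i \<in> {1..<length ps}"
  then have "ps ! (i - 1) < ps ! i"
    by (auto intro: sorted_wrt_nth_less)
  then have "\<rho> bot (ps ! i) = \<rho> bot (ps ! (i - 1)) + \<rho> (ps ! (i - 1)) (ps ! i)"
    by (simp add: rank_add)
  then show "chow_factor (\<rho> bot (ps ! i) - \<rho> bot (ps ! (i - 1))) =
      chow_factor (\<rho> (ps ! (i - 1)) (ps ! i))"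
    by simp
qed

lemma upper_chow_rec:
  "upper_chow x = 1 + (\<Sum>y\<in>{x<..}. chow_factor (\<rho> x y) * upper_chow y)"
proof -
  have "upper_chow x =
      chain_weight [x] + (\<Sum>ps\<in>(\<Union>y\<in>{x<..}. (#) x ` chains_from y). chain_weight ps)"
    unfolding upper_chow_def
    by (subst chains_from_rec, subst sum.insert)
      (auto simp: finite_chains_from, auto simp: chains_from_def)
  also have "(\<Sum>ps\<in>(\<Union>y\<in>{x<..}. (#) x ` chains_from y). chain_weight ps) =
      (\<Sum>y\<in>{x<..}. \<Sum>ps\<in>(#) x ` chains_from y. chain_weight ps)"
    by (rule sum.UNION_disjoint) (auto simp: finite_chains_from, auto simp: chains_from_def)
  also have "\<dots> = (\<Sum>y\<in>{x<..}. chow_factor (\<rho> x y) * upper_chow y)"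
  proof (rule sum.cong [OF refl])
    fix y
    have "(\<Sum>ps\<in>(#) x ` chains_from y. chain_weight ps) =
        (\<Sum>qs\<in>chains_from y. chain_weight (x # qs))"
      by (simp add: sum.reindex)
    also have "\<dots> = chow_factor (\<rho> x y) * upper_chow y"
      unfolding upper_chow_def sum_distrib_left
      by (rule sum.cong) (auto simp: chains_from_def chain_weight_Cons)
    finally show "(\<Sum>ps\<in>(#) x ` chains_from y. chain_weight ps) =
        chow_factor (\<rho> x y) * upper_chow y" .
  qed
  finally show ?thesis by simp
qed

section \<open>Coefficients and their symmetry\<close>

text \<open>Integer arguments, with value 0 at negative ones, allow shifts and reflections of
  degrees without truncated subtraction.\<close>

definition chow_coeff :: "'a \<Rightarrow> int \<Rightarrow> int" where
  "chow_coeff x j = (if j < 0 then 0 else coeff (upper_chow x) (nat j))"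

lemma coeff_chow_factor_mult:
  "coeff (chow_factor k * upper_chow y) i = (\<Sum>m=1..<k. chow_coeff y (int i - int m))"
  by (auto simp: chow_factor_eq sum_distrib_right coeff_sum coeff_monom_mult chow_coeff_def
      nat_diff_distrib' intro!: sum.cong)

lemma chow_coeff_rec:
  "chow_coeff x j = of_bool (j = 0) +
     (\<Sum>y\<in>{x<..}. \<Sum>m=1..<\<rho> x y. chow_coeff y (j - int m))"
proof (cases "j < 0")
  case True
  then show ?thesis by (simp add: chow_coeff_def)
next
  case False
  then have "chow_coeff x j = coeff (upper_chow x) (nat j)"
    by (simp add: chow_coeff_def)
  also have "\<dots> = of_bool (j = 0) +
      (\<Sum>y\<in>{x<..}. \<Sum>m=1..<\<rho> x y. chow_coeff y (j - int m))"
    using False by (subst upper_chow_rec) (simp add: coeff_sum coeff_chow_factor_mult)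
  finally show ?thesis .
qed

lemma chow_coeff_top: "chow_coeff top j = of_bool (j = 0)"
  by (subst chow_coeff_rec) (simp add: greaterThan_def less_le_not_le)

lemma chow_coeff_0: "chow_coeff x 0 = 1"
  by (subst chow_coeff_rec) (auto simp: chow_coeff_def intro!: sum.neutral)

text \<open>The chains \<open>[x]\<close> and \<open>[x, top]\<close> together contribute 1 in each
  degree below \<open>\<rho> x top\<close>. The element \<open>top\<close> is split off because the
  symmetry below fails there: its polynomial 1 is not symmetric about
  \<open>(\<rho> top top - 1) / 2\<close>.\<close>

lemma chow_coeff_rec_below_top:
  assumes "x < top"
  shows "chow_coeff x j = of_bool (0 \<le> j \<and> j < int (\<rho> x top)) +
     (\<Sum>y\<in>{x<..<top}. \<Sum>m=1..<\<rho> x y. chow_coeff y (j - int m))"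
proof -
  have up: "{x<..} = insert top {x<..<top}"
    using assms by (auto simp: less_le)
  have "(\<Sum>m=1..<\<rho> x top. chow_coeff top (j - int m)) =
      (\<Sum>m=1..<\<rho> x top. if m = nat j then of_bool (0 < j) else 0)"
    by (rule sum.cong) (auto simp: chow_coeff_top)
  also have "\<dots> = of_bool (0 < j \<and> j < int (\<rho> x top))"
    by (subst sum.delta) (auto simp: nat_less_iff)
  finally have "(\<Sum>m=1..<\<rho> x top. chow_coeff top (j - int m)) =
      of_bool (0 < j \<and> j < int (\<rho> x top))" .
  moreover have "0 < \<rho> x top"
    using assms by simp
  ultimately show ?thesis
    by (subst chow_coeff_rec) (auto simp: up)
qed

text \<open>By additivity of the rank, replacing \<open>m\<close> by \<open>\<rho> x y - m\<close>
  turns the reflection for \<open>x\<close> into the one for \<open>y\<close>; hence by induction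
  all blocks are symmetric about the same centre.\<close>

lemma chow_coeff_symmetric:
  assumes "x < top"
  shows "chow_coeff x (int (\<rho> x top) - 1 - j) = chow_coeff x j"
  using assms
proof (induction x arbitrary: j rule: finite_up_induct)
  case (less x)
  have "(\<Sum>m=1..<\<rho> x y. chow_coeff y (int (\<rho> x top) - 1 - j - int m)) =
      (\<Sum>m=1..<\<rho> x y. chow_coeff y (j - int m))" if y: "y \<in> {x<..<top}" for y
  proof (rule sum.reindex_bij_witness[of _ "\<lambda>m. \<rho> x y - m" "\<lambda>m. \<rho> x y - m"])
    fix m assume m: "m \<in> {1..<\<rho> x y}"
    have "int (\<rho> x top) - 1 - j - int m = int (\<rho> y top) - 1 - (j - int (\<rho> x y - m))"
      using m y rank_top[of x y] by (simp add: of_nat_diff less_imp_le)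
    then show "chow_coeff y (j - int (\<rho> x y - m)) =
        chow_coeff y (int (\<rho> x top) - 1 - j - int m)"
      using less.IH[of y "j - int (\<rho> x y - m)"] y by (simp only:) simp
  qed auto
  then show ?case
    using less.prems by (subst (1 2) chow_coeff_rec_below_top) auto
qed

section \<open>Ballot monomials\<close>

text \<open>
  Since \<open>\<rho>\<close> is additive, it suffices to bound the exponent of \<open>p\<close> by the distance to its
  predecessor; the bound for all smaller \<open>q\<close> is equivalent and evidently inherited by divisors.
\<close>

definition ballot :: "'a \<Rightarrow> 'a multiset set" where
  "ballot x = {M. (\<forall>p\<in>#M. x < p) \<and> (\<forall>p\<in>#M. \<forall>q\<in>#M. p \<le> q \<or> q \<le> p) \<and>
     (\<forall>p\<in>#M. \<forall>q\<in>insert x (set_mset M). q < p \<longrightarrow> count M p < \<rho> q p) \<and>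
     (\<forall>p\<in>#M. count M p + 2 * size (filter_mset ((<) p) M) \<le> \<rho> p top)}"

lemma empty_in_ballot [simp]: "{#} \<in> ballot x"
  by (simp add: ballot_def)

lemma ballot_subset_mset:
  assumes M: "M \<in> ballot x" and "d \<subseteq># M"
  shows "d \<in> ballot x"
proof -
  have cnt: "count d p \<le> count M p" and el: "p \<in># d \<Longrightarrow> p \<in># M"
    and sz: "size (filter_mset ((<) p) d) \<le> size (filter_mset ((<) p) M)" for p
    using assms(2) by (auto simp: mset_subset_eq_count mset_subset_eqD
        intro: size_mset_mono multiset_filter_mono)
  have "count d p < \<rho> q p" if "p \<in># d" "q \<in> insert x (set_mset d)" "q < p" for p q
  proof -
    have "count M p < \<rho> q p"
      using M that el unfolding ballot_def by blast
    then show ?thesis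
      using cnt[of p] by simp
  qed
  moreover have "count d p + 2 * size (filter_mset ((<) p) d) \<le> \<rho> p top" if "p \<in># d" for p
  proof -
    have "count M p + 2 * size (filter_mset ((<) p) M) \<le> \<rho> p top"
      using M that el unfolding ballot_def by blast
    then show ?thesis
      using cnt[of p] sz[of p] by linarith
  qed
  ultimately show ?thesis
    using M el unfolding ballot_def by blast
qed

text \<open>All elements of \<open>M\<close> lie above \<open>y\<close>, so their ballot
  inequalities do not see the new factor. Their exponent bounds relative to \<open>x\<close> follow
  from \<open>\<rho> y p \<le> \<rho> x p\<close>.\<close>

lemma ballot_addI:
  assumes M: "M \<in> ballot y" and y: "x < y" and m: "m < \<rho> x y"
    and bal: "m + 2 * size M \<le> \<rho> y top"
  shows "replicate_mset m y + M \<in> ballot x"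
proof -
  let ?M = "replicate_mset m y + M"
  have gt: "y < p" if "p \<in># M" for p
    using M that by (simp add: ballot_def)
  then have y0: "count M y = 0" and fM: "filter_mset ((<) y) M = M"
    by (auto simp: count_eq_zero_iff filter_mset_eq_conv)
  have cnt: "count ?M p = count M p" "filter_mset ((<) p) ?M = filter_mset ((<) p) M"
    if "p \<in># M" for p
    using gt[OF that] by (auto simp: filter_mset_eq_conv)
  have "x < p" if "p \<in># ?M" for p
    using that gt[of p] y by (auto split: if_splits)
  moreover have "p \<le> q \<or> q \<le> p" if "p \<in># ?M" "q \<in># ?M" for p q
    using that M gt[of p] gt[of q] by (auto simp: ballot_def split: if_splits)
  moreover have "count ?M p < \<rho> q p"
    if "p \<in># ?M" "q \<in> insert x (set_mset ?M)" "q < p" for p q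
  proof (cases "p \<in># M")
    case True
    have *: "count M p < \<rho> y p" "q \<in># M \<Longrightarrow> count M p < \<rho> q p"
      using True M gt[OF True] that by (auto simp: ballot_def)
    moreover have "\<rho> y p \<le> \<rho> x p"
      using rank_add[of x y p] y gt[OF True] by simp
    ultimately show ?thesis
      using that cnt[OF True] by (auto split: if_splits)
  next
    case False
    then have "p = y" "q = x"
      using that gt[of q] by (auto split: if_splits dest: less_asym)
    then show ?thesis
      using y0 m by simp
  qed
  moreover have "count ?M p + 2 * size (filter_mset ((<) p) ?M) \<le> \<rho> p top"
    if "p \<in># ?M" for p
  proof (cases "p \<in># M")
    case True
    then show ?thesis
      unfolding cnt[OF True] using True M by (simp add: ballot_def)
  next
    case False
    then have "p = y"
      using that by (auto split: if_splits)
    have "filter_mset ((<) y) (replicate_mset m y) = {#}"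
      by (rule multiset_eqI) auto
    then have "filter_mset ((<) y) ?M = M"
      using fM by simp
    then show ?thesis
      unfolding \<open>p = y\<close> using bal y0 by simp
  qed
  ultimately show ?thesis
    unfolding ballot_def by blast
qed

text \<open>Inverse to \<open>ballot_addI\<close>: the support is a chain, so its minimal element
  \<open>y\<close> is least and plays the part of the first chain element above
  \<open>x\<close>.\<close>

lemma ballot_cases [consumes 1, case_names empty add]:
  assumes "M \<in> ballot x"
  obtains "M = {#}"
  | y m M' where "M = replicate_mset m y + M'" "M' \<in> ballot y" "x < y" "0 < m" "m < \<rho> x y"
      "m + 2 * size M' \<le> \<rho> y top"
proof (cases "M = {#}")
  case False
  then obtain y where y: "y \<in># M" "\<And>q. q \<in># M \<Longrightarrow> q \<le> y \<Longrightarrow> y = q"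
    using finite_has_minimal[of "set_mset M"] by auto
  define M' where "M' = filter_mset ((<) y) M"
  have ge: "y \<le> q" if "q \<in># M" for q
    using assms y that unfolding ballot_def by blast
  have eq: "M = replicate_mset (count M y) y + M'"
    by (rule multiset_eqI) (use ge in \<open>auto simp: M'_def less_le count_eq_zero_iff\<close>)
  have "count M' p = count M p \<and> filter_mset ((<) p) M' = filter_mset ((<) p) M" if "p \<in># M'" for p
    using that ge by (auto simp: M'_def filter_filter_mset intro!: filter_mset_cong)
  then have "M' \<in> ballot y"
    using assms y(1) unfolding ballot_def by (auto simp: M'_def)
  moreover have "x < y" "count M y < \<rho> x y" "count M y + 2 * size M' \<le> \<rho> y top"
    using assms y(1) unfolding ballot_def M'_def by auto
  ultimately show ?thesis
    using that(2)[OF eq] y(1) by auto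
qed (use that in blast)

text \<open>Adding \<open>m < \<rho> x y\<close> to the ballot inequality at the least element gives
  \<open>2 * size M < \<rho> x y + \<rho> y top\<close>.\<close>

lemma ballot_size:
  assumes "M \<in> ballot x" "x < top"
  shows "2 * size M + 1 \<le> \<rho> x top"
  using assms(1)
proof (cases rule: ballot_cases)
  case empty
  then show ?thesis
    using assms(2) by (simp add: Suc_le_eq)
next
  case (add y m M')
  then show ?thesis
    using rank_top[of x y] by simp
qed

lemma ballot_top: "ballot top = {{#}}"
  by (auto simp: ballot_def less_le_not_le intro: multiset_eqI)

section \<open>Counting ballot monomials\<close>

definition ballot_count :: "'a \<Rightarrow> int \<Rightarrow> int" where
  "ballot_count x j = int (card {M \<in> ballot x. int (size M) = j})"

lemma finite_ballot: "finite (ballot x)"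
proof (induction x rule: finite_up_induct)
  case (less x)
  have "ballot x \<subseteq> insert {#} (\<Union>y\<in>{x<..}. \<Union>m\<in>{..<\<rho> x y}. (+) (replicate_mset m y) ` ballot y)"
  proof
    fix M assume "M \<in> ballot x"
    then show "M \<in> insert {#} (\<Union>y\<in>{x<..}. \<Union>m\<in>{..<\<rho> x y}. (+) (replicate_mset m y) ` ballot y)"
      by (cases rule: ballot_cases) auto
  qed
  then show ?case
    by (rule finite_subset) (use less in auto)
qed

text \<open>Nonempty ballot monomials correspond to triples of least element, exponent and
  remainder. In total degree \<open>j\<close> the remainder has degree \<open>j - m\<close>, so the
  ballot inequality reads \<open>2 * j - m \<le> \<rho> y top\<close> and does not depend on the
  remainder.\<close>

lemma ballot_count_rec:
  "ballot_count x j = of_bool (j = 0) + (\<Sum>y\<in>{x<..}. \<Sum>m=1..<\<rho> x y.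
     if 2 * j - int m \<le> int (\<rho> y top) then ballot_count y (j - int m) else 0)"
proof -
  define B where "B y m = {M \<in> ballot y. int (size M) = j - int m \<and>
    2 * j - int m \<le> int (\<rho> y top)}" for y m
  define S where "S = (SIGMA y:{x<..}. SIGMA m:{1..<\<rho> x y}. B y m)"
  define f :: "'a \<times> nat \<times> 'a multiset \<Rightarrow> 'a multiset" where
    "f = (\<lambda>(y, m, M). replicate_mset m y + M)"
  have finB: "finite (B y m)" for y m
    unfolding B_def using finite_ballot by auto
  have above: "y < p" if "M \<in> B y m" "p \<in># M" for y m p M
    using that by (auto simp: B_def ballot_def)
  have "inj_on f S"
  proof (rule inj_onI)
    fix s s' assume s: "s \<in> S" "s' \<in> S" "f s = f s'"
    obtain y m M where [simp]: "s = (y, m, M)" by (cases s)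
    obtain y' m' M' where [simp]: "s' = (y', m', M')" by (cases s')
    have pos: "0 < m" "0 < m'" and MB: "M \<in> B y m" "M' \<in> B y' m'"
      using s by (auto simp: S_def)
    have eq: "replicate_mset m y + M = replicate_mset m' y' + M'"
      using s by (simp add: f_def)
    \<comment> \<open>If \<open>y\<close> and \<open>y'\<close> differed, each would occur in the
      remainder of the other decomposition and so lie strictly above the other.\<close>
    have "y \<in># replicate_mset m' y' + M'" "y' \<in># replicate_mset m y + M"
      using pos eq[symmetric] by (simp, simp add: eq)
    then have "y = y'"
      using above[OF MB(1), of y'] above[OF MB(2), of y] by (auto split: if_splits dest: less_asym)
    moreover have "count M y = 0" "count M' y' = 0"
      using above[OF MB(1), of y] above[OF MB(2), of y'] by (auto simp: count_eq_zero_iff)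
    then have "m = m'"
      using \<open>y = y'\<close> arg_cong[OF eq, of "\<lambda>A. count A y"] by simp
    ultimately show "s = s'"
      using eq by simp
  qed
  then have "card (f ` S) = card S"
    by (rule card_image)
  also have "\<dots> = (\<Sum>y\<in>{x<..}. \<Sum>m=1..<\<rho> x y. card (B y m))"
    unfolding S_def by (subst card_SigmaI) (auto simp: finB card_SigmaI intro!: finite_SigmaI)
  finally have "int (card (f ` S)) = (\<Sum>y\<in>{x<..}. \<Sum>m=1..<\<rho> x y.
     if 2 * j - int m \<le> int (\<rho> y top) then ballot_count y (j - int m) else 0)"
    by (auto simp: B_def ballot_count_def intro!: sum.cong)
  moreover have "{M \<in> ballot x. int (size M) = j} = {M. M = {#} \<and> j = 0} \<union> f ` S"
  proof (intro equalityI subsetI)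
    fix M assume M: "M \<in> {M \<in> ballot x. int (size M) = j}"
    then have "M \<in> ballot x" by simp
    then show "M \<in> {M. M = {#} \<and> j = 0} \<union> f ` S"
    proof (cases rule: ballot_cases)
      case empty
      then show ?thesis using M by simp
    next
      case (add y m M')
      then have "(y, m, M') \<in> S" "f (y, m, M') = M"
        using M by (auto simp: S_def B_def f_def)
      then show ?thesis by blast
    qed
  next
    fix M assume "M \<in> {M. M = {#} \<and> j = 0} \<union> f ` S"
    then show "M \<in> {M \<in> ballot x. int (size M) = j}"
    proof
      assume "M \<in> f ` S"
      then obtain y m M' where M: "M = replicate_mset m y + M'" "x < y" "m < \<rho> x y" "M' \<in> B y m"
        by (auto simp: S_def f_def)
      then have "m + 2 * size M' \<le> \<rho> y top"
        by (auto simp: B_def)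
      with M show ?thesis
        using ballot_addI[of M' y x m] by (auto simp: B_def)
    qed auto
  qed
  moreover have "{M. M = {#} \<and> j = 0} \<inter> f ` S = {}"
    by (auto simp: f_def S_def)
  moreover have "finite S"
    unfolding S_def using finB by (intro finite_SigmaI) auto
  moreover have "card {M :: 'a multiset. M = {#} \<and> j = 0} = of_bool (j = 0)"
    by auto
  ultimately show ?thesis
    unfolding ballot_count_def
    by (simp add: card_Un_disjoint)
qed

section \<open>Differences of Chow coefficients\<close>

lemma ballot_count_eq_0:
  assumes "x < top" "2 * j > int (\<rho> x top) - 1"
  shows "ballot_count x j = 0"
proof -
  have "{M \<in> ballot x. int (size M) = j} = {}"
    using ballot_size[OF _ assms(1)] assms(2) by force
  then show ?thesis
    unfolding ballot_count_def by (simp only: card.empty)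
qed

text \<open>Differencing \<open>chow_coeff_rec_below_top\<close> leaves blocks of differences at
  \<open>y\<close>. To these \<open>sum_reflection_cancel\<close> applies with
  \<open>N = \<rho> y top - 1\<close> and \<open>d = \<rho> x y\<close>, its bound on
  \<open>i\<close> being the assumption on \<open>j\<close>. The result matches
  \<open>ballot_count_rec\<close>.\<close>

lemma chow_coeff_diff:
  assumes "x < top" "2 * j \<le> int (\<rho> x top) - 1"
  shows "chow_coeff x j - chow_coeff x (j - 1) = ballot_count x j"
  using assms
proof (induction x arbitrary: j rule: finite_up_induct)
  case (less x)
  let ?D = "\<lambda>y j. chow_coeff y j - chow_coeff y (j - 1)"
  have blk: "(\<Sum>m=1..<\<rho> x y. ?D y (j - int m)) = (\<Sum>m=1..<\<rho> x y.
      if 2 * j - int m \<le> int (\<rho> y top) then ballot_count y (j - int m) else 0)"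
    if y: "y \<in> {x<..<top}" for y
  proof -
    let ?N = "int (\<rho> y top) - 1"
    \<comment> \<open>The induction hypothesis settles the lower half \<open>2 * i \<le> ?N\<close>,
      where the reflected count vanishes. Symmetry of the coefficients makes the differences
      antisymmetric, which gives the upper half; at the fixed point \<open>2 * i = ?N + 1\<close>
      both sides are 0.\<close>
    have D: "?D y i = ballot_count y i - ballot_count y (?N + 1 - i)" for i
    proof (cases "2 * i \<le> ?N")
      case True
      then show ?thesis
        using less.IH[of y i] ballot_count_eq_0[of y "?N + 1 - i"] y by simp
    next
      case False
      then have b: "ballot_count y i = 0"
        using ballot_count_eq_0[of y i] y by simp
      have D: "?D y (?N + 1 - i) = - ?D y i"
        using chow_coeff_symmetric[of y i] chow_coeff_symmetric[of y "i - 1"] y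
        by (simp add: algebra_simps)
      show ?thesis
      proof (cases "2 * i = ?N + 1")
        case True
        then have "?N + 1 - i = i" by simp
        then show ?thesis
          using b D by simp
      next
        case nontrivial: False
        then have "?D y (?N + 1 - i) = ballot_count y (?N + 1 - i)"
          using False less.IH[of y "?N + 1 - i"] y by simp
        then show ?thesis
          using b D by linarith
      qed
    qed
    have "2 * j \<le> ?N + int (\<rho> x y)"
      using less.prems rank_top[of x y] y by (simp add: less_imp_le)
    then show ?thesis
      using sum_reflection_cancel[of "?D y" "ballot_count y" ?N j "\<rho> x y"] D
        ballot_count_eq_0[of y] y by simp
  qed
  have "?D x j = of_bool (j = 0) + (\<Sum>y\<in>{x<..<top}. \<Sum>m=1..<\<rho> x y. ?D y (j - int m))"
  proof -
    have "0 < \<rho> x top" using less.prems by simp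
    \<comment> \<open>The indicator jumps at 0 and at \<open>\<rho> x top\<close>; the bound on
      \<open>j\<close> excludes the second jump.\<close>
    then have "of_bool (0 \<le> j \<and> j < int (\<rho> x top)) - of_bool (0 \<le> j - 1 \<and> j - 1 < int (\<rho> x top)) =
        (of_bool (j = 0) :: int)"
      using less.prems by auto
    then show ?thesis
      using less.prems
      by (subst (1 2) chow_coeff_rec_below_top) (auto simp: sum_subtractf algebra_simps)
  qed
  also have "\<dots> = of_bool (j = 0) + (\<Sum>y\<in>{x<..<top}. \<Sum>m=1..<\<rho> x y.
      if 2 * j - int m \<le> int (\<rho> y top) then ballot_count y (j - int m) else 0)"
    using blk by simp
  also have "(\<Sum>y\<in>{x<..<top}. \<Sum>m=1..<\<rho> x y.
      if 2 * j - int m \<le> int (\<rho> y top) then ballot_count y (j - int m) else 0) =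
    (\<Sum>y\<in>{x<..}. \<Sum>m=1..<\<rho> x y.
      if 2 * j - int m \<le> int (\<rho> y top) then ballot_count y (j - int m) else 0)"
  proof (rule sum.mono_neutral_left)
    \<comment> \<open>Only the empty monomial is ballot at \<open>top\<close>, so a nonzero term
      would need \<open>j = m\<close>, and then \<open>2 * j - m \<le> 0\<close> contradicts
      \<open>1 \<le> m\<close>.\<close>
    have "(if 2 * j - int m \<le> int (\<rho> top top) then ballot_count top (j - int m) else 0) = 0"
      if "m \<in> {1..<k}" for m k
    proof -
      have "{M \<in> ballot top. int (size M) = j - int m} = {}" if "2 * j \<le> int m"
        using that \<open>m \<in> {1..<k}\<close> by (auto simp: ballot_top)
      then have "ballot_count top (j - int m) = 0" if "2 * j \<le> int m"
        using that unfolding ballot_count_def by (simp only: card.empty)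
      then show ?thesis
        by (simp add: rank_eq_0_iff[THEN iffD2])
    qed
    then have "(\<Sum>m=1..<\<rho> x top.
        if 2 * j - int m \<le> int (\<rho> top top) then ballot_count top (j - int m) else 0) = 0"
      by (rule sum.neutral[OF ballI])
    moreover have "{x<..} - {x<..<top} \<subseteq> {top}"
      by (auto simp: less_le)
    ultimately show "\<forall>y\<in>{x<..} - {x<..<top}. (\<Sum>m=1..<\<rho> x y.
        if 2 * j - int m \<le> int (\<rho> y top) then ballot_count y (j - int m) else 0) = 0"
      by blast
  qed auto
  finally show ?case
    by (subst ballot_count_rec)
qed

end

section \<open>Enlarging ballot monomials in ranked posets\<close>

locale ranked_poset =
  fixes \<rho> :: "'a::{finite, order_bot, order_top} \<Rightarrow> 'a \<Rightarrow> nat"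
  assumes ranked: "ranked \<rho>"
begin

sublocale weak_ranked_poset \<rho>
  using ranked by unfold_locales (simp add: ranked_def)

lemma exists_rank_1:
  assumes "x < y"
  obtains z where "z \<le> y" "x < z" "\<rho> x z = 1"
  using exists_cover_below[OF assms] ranked unfolding ranked_def covers_def by metis

text \<open>An exponent is smaller than the distance to any smaller element of the chain, so a new
  variable needs distance at least 2 from \<open>x\<close>; two successive covers give exactly
  2.\<close>

lemma exists_rank_2:
  assumes "2 \<le> \<rho> x y"
  obtains z where "z \<le> y" "x < z" "\<rho> x z = 2"
proof -
  have "x < y"
    using assms rank_pos_iff[of x y] by linarith
  then obtain w where w: "w \<le> y" "x < w" "\<rho> x w = 1"
    by (rule exists_rank_1)
  then have "0 < \<rho> w y"
    using assms rank_add[of x w y] by (simp add: less_imp_le del: rank_pos_iff)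
  then have "w < y"
    by (simp only: rank_pos_iff)
  then obtain z where z: "z \<le> y" "w < z" "\<rho> w z = 1"
    by (rule exists_rank_1)
  then show thesis
    using that[of z] w rank_add[of x w z] by (auto simp: less_imp_le)
qed

text \<open>The cases follow the slack \<open>\<rho> x y - m\<close> at the least element
  \<open>y\<close> with exponent \<open>m\<close>. Slack at least 3 leaves room for a new element
  two ranks above \<open>x\<close>; slack 2 lets \<open>m\<close> grow by one; slack 1 is
  saturation, and the remainder is enlarged by induction.\<close>

lemma ballot_extend:
  assumes "M \<in> ballot x" "2 * size M + 3 \<le> \<rho> x top"
  obtains p where "add_mset p M \<in> ballot x"
proof -
  have "\<exists>p. add_mset p M \<in> ballot x"
    using assms
  proof (induction x arbitrary: M rule: finite_up_induct)
    case (less x)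
    have insert_low: ?case if y: "x < y" "3 \<le> \<rho> x y"
      and M: "\<And>z. x < z \<Longrightarrow> z < y \<Longrightarrow> \<rho> x z = 2 \<Longrightarrow> M \<in> ballot z" for y
    proof -
      obtain z where z: "z \<le> y" "x < z" "\<rho> x z = 2"
        using exists_rank_2[of x y] y by auto
      then have "z < y"
        using y by (auto simp: less_le)
      then have "replicate_mset 1 z + M \<in> ballot x"
        using M z less.prems rank_top[of x z] by (intro ballot_addI) auto
      then show ?thesis by auto
    qed
    from less.prems(1) show ?case
    proof (cases rule: ballot_cases)
      case empty
      moreover have "x < top"
        using less.prems rank_pos_iff[of x top] by linarith
      \<comment> \<open>In the absence of a least element, \<open>top\<close> serves as upper end of
        the gap.\<close>
      ultimately show ?thesis
        using insert_low[of top] less.prems by simp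
    next
      case (add y m M')
      have r: "\<rho> x top = \<rho> x y + \<rho> y top"
        using add by (simp add: rank_top)
      consider "m + 3 \<le> \<rho> x y" | "m + 2 = \<rho> x y" | "m + 1 = \<rho> x y"
        using add by linarith
      then show ?thesis
      proof cases
        case 1
        have "M \<in> ballot z" if "x < z" "z < y" "\<rho> x z = 2" for z
          using add that 1 rank_add[of x z y] by (auto intro!: ballot_addI)
        then show ?thesis
          using insert_low[of y] add 1 by auto
      next
        case 2
        then have "replicate_mset (Suc m) y + M' \<in> ballot x"
          using add less.prems r by (intro ballot_addI) auto
        then show ?thesis
          using add by auto
      next
        case 3
        \<comment> \<open>With \<open>\<rho> x y = m + 1\<close> the size hypothesis becomes
          \<open>m + 2 * size M' + 2 \<le> \<rho> y top\<close>. This is the ballot inequality at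
          \<open>y\<close> after the enlargement, and by \<open>0 < m\<close> it implies the size
          hypothesis for \<open>M'\<close>.\<close>
        then obtain p where "add_mset p M' \<in> ballot y"
          using less.IH[of y M'] add less.prems r by auto
        then have "replicate_mset m y + add_mset p M' \<in> ballot x"
          using add less.prems r 3 by (intro ballot_addI) auto
        then show ?thesis
          using add by auto
      qed
    qed
  qed
  then show thesis
    using that by blast
qed

lemma ballot_bot_size:
  assumes "M \<in> ballot bot"
  shows "size M \<le> (\<rho> bot top - 1) div 2"
proof (cases "(bot :: 'a) = top")
  \<comment> \<open>The one-element poset has rank 0, and truncated subtraction makes the bound
    0.\<close>
  case True
  then have "M \<in> ballot top"
    using assms by simp
  then show ?thesis
    by (simp add: ballot_top)
next
  case False
  then have "2 * size M + 1 \<le> \<rho> bot top"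
    using ballot_size[OF assms] by (simp add: less_le)
  then show ?thesis
    by linarith
qed

lemma ballot_bot_max_size:
  assumes "M \<in> ballot bot" "\<And>p. add_mset p M \<notin> ballot bot"
  shows "size M = (\<rho> bot top - 1) div 2"
proof -
  have "\<not> 2 * size M + 3 \<le> \<rho> bot top"
    using ballot_extend[OF assms(1)] assms(2) by blast
  then show ?thesis
    using ballot_bot_size[OF assms(1)] by linarith
qed

section \<open>The pure order ideal and the conclusion\<close>

lemma pure_O_sequence_ballot:
  "pure_O_sequence (map (\<lambda>i. ballot_count bot (int i)) [0..<Suc ((\<rho> bot top - 1) div 2)])"
proof -
  let ?k = "(\<rho> bot top - 1) div 2"
  \<comment> \<open>Variables of a \<open>monomial\<close> are natural numbers, so the elements of
    the poset are numbered injectively.\<close>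
  obtain e :: "'a \<Rightarrow> nat" where e: "inj e"
    using finite_imp_inj_to_nat_seg[OF finite_UNIV] by blast
  then have inj: "inj (image_mset e)"
    by (rule multiset.inj_map)
  define I where "I = image_mset e ` ballot bot"
  have ideal: "d \<in> I" if "m \<in> I" "d \<subseteq># m" for m d
  proof -
    obtain M where M: "M \<in> ballot bot" "m = image_mset e M"
      using \<open>m \<in> I\<close> by (auto simp: I_def)
    obtain D where "D \<subseteq># M" "d = image_mset e D"
      using \<open>d \<subseteq># m\<close> image_mset_eq_plusD[of e M d] unfolding M(2)
      by (metis mset_subset_eq_exists_conv)
    then show ?thesis
      using ballot_subset_mset M(1) by (auto simp: I_def)
  qed
  have max: "size m = ?k" if "m \<in> I" "\<not> (\<exists>m'\<in>I. m \<subset># m')" for m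
  proof -
    obtain M where M: "M \<in> ballot bot" "m = image_mset e M"
      using \<open>m \<in> I\<close> by (auto simp: I_def)
    have "add_mset p M \<notin> ballot bot" for p
    proof
      assume "add_mset p M \<in> ballot bot"
      then have "image_mset e (add_mset p M) \<in> I"
        unfolding I_def by (rule imageI)
      then show False
        using that(2) M(2) by auto
    qed
    then show ?thesis
      using ballot_bot_max_size[OF M(1)] M(2) by simp
  qed
  have fin: "finite I" and ne: "{#} \<in> I"
    using finite_ballot by (auto simp: I_def intro: rev_image_eqI[of "{#}"])
  have "Max (size ` I) = ?k"
  proof (rule Max_eqI)
    show "finite (size ` I)"
      using fin by simp
    show "s \<le> ?k" if "s \<in> size ` I" for s
      using that ballot_bot_size by (auto simp: I_def)
    \<comment> \<open>A monomial of largest degree is maximal under divisibility, hence of degree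
      \<open>?k\<close>. So \<open>?k\<close> is attained and the vector has the right
      length.\<close>
    have "Max (size ` I) \<in> size ` I"
      using fin ne by (intro Max_in) auto
    then obtain m where m: "m \<in> I" "size m = Max (size ` I)"
      by auto
    have "\<not> (\<exists>m'\<in>I. m \<subset># m')"
      using m fin by (metis Max_ge finite_imageI imageI leD mset_subset_size)
    then show "?k \<in> size ` I"
      using max m(1) by force
  qed
  moreover have "int (card {m \<in> I. size m = d}) = ballot_count bot (int d)" for d
  proof -
    have "{m \<in> I. size m = d} = image_mset e ` {M \<in> ballot bot. int (size M) = int d}"
      by (auto simp: I_def)
    then show ?thesis
      unfolding ballot_count_def by (simp only: card_image[OF inj_on_subset[OF inj subset_UNIV]])
  qed
  ultimately have "map (\<lambda>i. ballot_count bot (int i)) [0..<Suc ?k] = map int (h_vector I)"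
    by (simp add: h_vector_def)
  moreover have "monomial_order_ideal I"
    using fin ideal by (auto simp: monomial_order_ideal_def)
  moreover have "pure I"
    using max by (auto simp: pure_def maximal_monomials_def)
  ultimately show ?thesis
    using ne unfolding pure_O_sequence_def by blast
qed

end

theorem theorem1p3:
  fixes \<rho> :: "'a::{finite, order_bot, order_top} \<Rightarrow> 'a \<Rightarrow> nat"
    and n :: nat and h :: "nat \<Rightarrow> int"
  assumes "ranked \<rho>"
    and "poset_rank \<rho> = n"
    and "\<And>i. h i = coeff (chow_poly \<rho>) i"
  shows "pure_O_sequence
           (h 0 # map (\<lambda>i. h i - h (i - 1)) [1..<Suc ((n - 1) div 2)])"
proof -
  interpret ranked_poset \<rho>
    by unfold_locales (fact assms(1))
  have n: "n = \<rho> bot top"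
    using assms(2) by (simp add: poset_rank_def)
  have h: "h i = chow_coeff bot (int i)" for i
    by (simp add: assms(3) chow_coeff_def chow_poly_eq_upper_chow)
  \<comment> \<open>Degree 0 is counted directly, which also covers the one-element poset, where
    \<open>chow_coeff_diff\<close> does not apply.\<close>
  have "{M \<in> ballot bot. int (size M) = 0} = {{#}}"
    by auto
  then have "h 0 = ballot_count bot 0"
    by (simp add: h chow_coeff_0 ballot_count_def)
  moreover have "h i - h (i - 1) = ballot_count bot (int i)"
    if "i \<in> {1..<Suc ((n - 1) div 2)}" for i
  proof -
    \<comment> \<open>An index \<open>1 \<le> i\<close> in the list forces \<open>3 \<le> n\<close>,
      so \<open>n - 1\<close> is not truncated and \<open>bot < top\<close>.\<close>
    have i: "1 \<le> i" "2 * i + 1 \<le> n"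
      using that by auto
    then have "(bot :: 'a) < top"
      using n rank_pos_iff[of bot top] by linarith
    then show ?thesis
      using chow_coeff_diff[of bot "int i"] i n by (simp add: h of_nat_diff)
  qed
  ultimately have "h 0 # map (\<lambda>i. h i - h (i - 1)) [1..<Suc ((n - 1) div 2)] =
      map (\<lambda>i. ballot_count bot (int i)) [0..<Suc ((n - 1) div 2)]"
    by (subst upt_conv_Cons[of 0]) auto
  then show ?thesis
    using pure_O_sequence_ballot n by simp
qed

end
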